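(* Let $(T_i)_{i=1}^{\infty}$ be a submultiplicative sequence of bounded linear operators on a separable Banach space $X$. Then the following assertions are equivalent: (1) $(T_i)_{i}$ is densely mean Li-Yorke chaotic; (2) $(T_i)_{i}$ has a dense set (in $X\times X$) of mean Li-Yorke pairs; (3) $(T_i)_{i}$ has a dense set (in $X$) of absolutely mean semi-irregular vectors; (4) $(T_i)_{i}$ has a residual set (in $X$) of absolutely mean irregular vectors; (5) the mean proximal relation of $(T_i)_{i}$ is dense in $X\times X$ and $(T_i)_{i}$ is mean sensitive; (6) the mean proximal cell of $\mathbf{0}$ is dense in $X$ and there exists a vector $x\in X$ such that $\limsup_{n\to\infty}\frac{1}{n}\sum_{i=1}^{n}\Vert T_ix\Vert>0$.
   Context: A sequence $(T_i)_{i=1}^\infty$ of bounded linear operators on a Banach space $X$ (i.e. from $X$ to $X$) is \emph{submultiplicative} if there exists a constant $C>0$ such that $\Vert T_{i+m}z\Vert\le C\Vert T_iT_mz\Vert$ for all $z\in X$ and $i,m\in\mathbb{N}=\{1,2,\dots\}$. A pair $(x,y)\in X\times X$ is \emph{mean proximal} if $\liminf_{n\to\infty}\frac1n\sum_{i=1}^n\Vert T_ix-T_iy\Vert=0$; the \emph{mean proximal relation} is the set of all mean proximal pairs, and the \emph{mean proximal cell} of $\mathbf 0$ (the zero vector) is the set of $y\in X$ such that $(\mathbf 0,y)$ is mean proximal. A \emph{mean Li-Yorke pair} is a mean proximal pair $(x,y)$ with $\limsup_{n\to\infty}\frac1n\sum_{i=1}^n\Vert T_ix-T_iy\Vert>0$.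 A subset of $X$ is \emph{mean Li-Yorke scrambled} if any two distinct points of it form a mean Li-Yorke pair; $(T_i)_i$ is \emph{densely mean Li-Yorke chaotic} if there exists a dense uncountable mean Li-Yorke scrambled subset of $X$. A vector $x\in X$ is \emph{absolutely mean semi-irregular} (resp. \emph{absolutely mean irregular}) if $\liminf_{n\to\infty}\frac1n\sum_{i=1}^n\Vert T_ix\Vert=0$ and $\limsup_{n\to\infty}\frac1n\sum_{i=1}^n\Vert T_ix\Vert>0$ (resp. $=\infty$). $(T_i)_i$ is \emph{mean sensitive} if there is $\delta>0$ such that for every $x\in X$ and $\varepsilon>0$ there exists $y\in X$ with $\Vert x-y\Vert<\varepsilon$ and $\limsup_{n\to\infty}\frac{1}{n}\sum_{i=1}^{n}\Vert T_ix-T_iy\Vert>\delta$. A set is residual if it contains a dense $G_\delta$ set. *)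

theory Defs
  imports "HOL-Analysis.Analysis"
begin

text \<open>
  Operator sequences are indexed by the positive integers; the value \<open>T 0\<close> is a dummy
  that no definition below uses.  Upper and lower limits of averages are taken in
  \<^typ>\<open>ereal\<close>, so that they may be infinite.
\<close>

definition submultiplicative :: "(nat \<Rightarrow> 'a::real_normed_vector \<Rightarrow> 'a) \<Rightarrow> bool" where
  "submultiplicative T \<longleftrightarrow>
     (\<exists>C>0. \<forall>z. \<forall>i\<ge>1. \<forall>m\<ge>1. norm (T (i + m) z) \<le> C * norm (T i (T m z)))"

definition mean_dist :: "(nat \<Rightarrow> 'a::real_normed_vector \<Rightarrow> 'a) \<Rightarrow> 'a \<Rightarrow> 'a \<Rightarrow> nat \<Rightarrow> real" where
  "mean_dist T x y n = (1 / real n) * (\<Sum>i=1..n. norm (T i x - T i y))"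

definition mean_norm :: "(nat \<Rightarrow> 'a::real_normed_vector \<Rightarrow> 'a) \<Rightarrow> 'a \<Rightarrow> nat \<Rightarrow> real" where
  "mean_norm T x n = (1 / real n) * (\<Sum>i=1..n. norm (T i x))"

definition mean_proximal :: "(nat \<Rightarrow> 'a::real_normed_vector \<Rightarrow> 'a) \<Rightarrow> 'a \<Rightarrow> 'a \<Rightarrow> bool" where
  "mean_proximal T x y \<longleftrightarrow> liminf (\<lambda>n. ereal (mean_dist T x y n)) = 0"

definition mean_proximal_relation :: "(nat \<Rightarrow> 'a::real_normed_vector \<Rightarrow> 'a) \<Rightarrow> ('a \<times> 'a) set" where
  "mean_proximal_relation T = {(x, y). mean_proximal T x y}"

definition mean_proximal_cell :: "(nat \<Rightarrow> 'a::real_normed_vector \<Rightarrow> 'a) \<Rightarrow> 'a \<Rightarrow> 'a set" where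
  "mean_proximal_cell T x = {y. mean_proximal T x y}"

definition mean_Li_Yorke_pair :: "(nat \<Rightarrow> 'a::real_normed_vector \<Rightarrow> 'a) \<Rightarrow> 'a \<Rightarrow> 'a \<Rightarrow> bool" where
  "mean_Li_Yorke_pair T x y \<longleftrightarrow>
     mean_proximal T x y \<and> limsup (\<lambda>n. ereal (mean_dist T x y n)) > 0"

definition mean_Li_Yorke_scrambled :: "(nat \<Rightarrow> 'a::real_normed_vector \<Rightarrow> 'a) \<Rightarrow> 'a set \<Rightarrow> bool" where
  "mean_Li_Yorke_scrambled T S \<longleftrightarrow> pairwise (mean_Li_Yorke_pair T) S"

definition densely_mean_Li_Yorke_chaotic :: "(nat \<Rightarrow> 'a::real_normed_vector \<Rightarrow> 'a) \<Rightarrow> bool" where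
  "densely_mean_Li_Yorke_chaotic T \<longleftrightarrow>
     (\<exists>S. closure S = UNIV \<and> uncountable S \<and> mean_Li_Yorke_scrambled T S)"

definition absolutely_mean_semi_irregular ::
    "(nat \<Rightarrow> 'a::real_normed_vector \<Rightarrow> 'a) \<Rightarrow> 'a \<Rightarrow> bool" where
  "absolutely_mean_semi_irregular T x \<longleftrightarrow>
     liminf (\<lambda>n. ereal (mean_norm T x n)) = 0 \<and> limsup (\<lambda>n. ereal (mean_norm T x n)) > 0"

definition absolutely_mean_irregular ::
    "(nat \<Rightarrow> 'a::real_normed_vector \<Rightarrow> 'a) \<Rightarrow> 'a \<Rightarrow> bool" where
  "absolutely_mean_irregular T x \<longleftrightarrow>
     liminf (\<lambda>n. ereal (mean_norm T x n)) = 0 \<and> limsup (\<lambda>n. ereal (mean_norm T x n)) = \<infinity>"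

definition mean_sensitive :: "(nat \<Rightarrow> 'a::real_normed_vector \<Rightarrow> 'a) \<Rightarrow> bool" where
  "mean_sensitive T \<longleftrightarrow>
     (\<exists>\<delta>>0. \<forall>x. \<forall>\<epsilon>>0. \<exists>y. norm (x - y) < \<epsilon> \<and>
        limsup (\<lambda>n. ereal (mean_dist T x y n)) > ereal \<delta>)"

definition residual :: "'a::topological_space set \<Rightarrow> bool" where
  "residual S \<longleftrightarrow> (\<exists>G\<subseteq>S. gdelta_in euclidean G \<and> closure G = UNIV)"

end

(*
  The averages M_n x of the norms of T_i x are continuous seminorms.  Dense mean proximal cell means
  that liminf M_n = 0 on a residual set.  If limsup M_n = infinity failed on a residual set, then by
  the uniform boundedness argument M_n x \<le> K |x| for all large n; for y in the cell some
  T_i y is small, and submultiplicativity together with this bound makes limsup M_n y small, so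
  M_n y \<longlonglongrightarrow> 0 on the dense cell and hence everywhere by equicontinuity.  This yields
  (6) \<Longrightarrow> (4).  For (4) \<Longrightarrow> (1) a countable dense scrambled set is extended
  to a maximal one, which is uncountable because a countable scrambled set can always be enlarged by
  Baire's theorem.  The other implications pass between pairs and their differences.
*)

theory Submission
  imports Defs
begin

section \<open>Residual sets\<close>

lemma dense_iff:
  fixes S :: "'a::topological_space set"
  shows "closure S = UNIV \<longleftrightarrow> (\<forall>U. open U \<and> U \<noteq> {} \<longrightarrow> S \<inter> U \<noteq> {})"
proof
  assume "closure S = UNIV"
  then show "\<forall>U. open U \<and> U \<noteq> {} \<longrightarrow> S \<inter> U \<noteq> {}"
    using open_Int_closure_eq_empty[of _ S] by (auto simp: Int_commute)
next
  assume *: "\<forall>U. open U \<and> U \<noteq> {} \<longrightarrow> S \<inter> U \<noteq> {}"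
  have "S \<inter> - closure S = {}" using closure_subset by blast
  with * have "- closure S = {}" by (meson closed_closure open_Compl)
  then show "closure S = UNIV" by blast
qed

text \<open>Subtraction is continuous and sends \<open>(u, 0)\<close> to \<open>u\<close>, so the
  preimage of a nonempty open set is again open and nonempty. The lemma carries density from pairs
  to differences.\<close>

lemma dense_differences:
  fixes P :: "'a::real_normed_vector \<Rightarrow> bool"
  assumes "closure {(x, y). P (x - y)} = UNIV"
  shows "closure {z. P z} = UNIV"
  unfolding dense_iff
proof (intro allI impI)
  fix U :: "'a set" assume U: "open U \<and> U \<noteq> {}"
  define W where "W = (\<lambda>p. fst p - snd p) -` U"
  obtain u where "u \<in> U" using U by blast
  then have "(u, 0) \<in> W" by (simp add: W_def)
  moreover have "open W"
    unfolding W_def using U by (intro open_vimage continuous_intros) auto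
  ultimately have "{(x, y). P (x - y)} \<inter> W \<noteq> {}"
    using assms unfolding dense_iff by blast
  then show "{z. P z} \<inter> U \<noteq> {}" unfolding W_def by auto
qed

lemma Baire_dense:
  fixes \<D> :: "'a::complete_space set set"
  assumes "countable \<D>" "\<And>D. D \<in> \<D> \<Longrightarrow> open D \<and> closure D = UNIV"
  shows "closure (\<Inter>\<D>) = UNIV"
  using Baire_category[of "euclidean :: 'a topology" \<D>] assms completely_metrizable_space_euclidean[where 'a = 'a]
  by auto

text \<open>Each open factor of a dense G-delta set is dense because it contains that set; Baire's
  theorem gives the converse. In this form residuality is checked on one open set at a time.\<close>

lemma residual_iff:
  fixes S :: "'a::complete_space set"
  shows "residual S \<longleftrightarrow>
    (\<exists>\<D>. countable \<D> \<and> (\<forall>D\<in>\<D>. open D \<and> closure D = UNIV) \<and> \<Inter>\<D> \<subseteq> S)"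
proof
  assume "residual S"
  then obtain G where G: "G \<subseteq> S" "(countable intersection_of open) G" "closure G = UNIV"
    unfolding residual_def gdelta_in_alt by auto
  then obtain \<D> where \<D>: "countable \<D>" "\<D> \<subseteq> Collect open" "\<Inter>\<D> = G"
    unfolding intersection_of_def by auto
  have "closure D = UNIV" if "D \<in> \<D>" for D
    using closure_mono[of G D] that \<D>(3) G(3) by auto
  with \<D> G(1) show "\<exists>\<D>. countable \<D> \<and> (\<forall>D\<in>\<D>. open D \<and> closure D = UNIV) \<and> \<Inter>\<D> \<subseteq> S"
    by blast
next
  assume "\<exists>\<D>. countable \<D> \<and> (\<forall>D\<in>\<D>. open D \<and> closure D = UNIV) \<and> \<Inter>\<D> \<subseteq> S"
  then obtain \<D> where \<D>: "countable \<D>" "\<forall>D\<in>\<D>. open D \<and> closure D = UNIV" "\<Inter>\<D> \<subseteq> S"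
    by blast
  have "gdelta_in euclidean (\<Inter>\<D>)"
  \<comment> \<open>The empty family has the whole space as its intersection and is treated apart,
    since \<open>gdelta_in_Inter\<close> speaks of nonempty families.\<close>
  proof (cases "\<D> = {}")
    case True
    then show ?thesis using gdelta_in_topspace[of euclidean] by simp
  next
    case False
    then show ?thesis using \<D> by (intro gdelta_in_Inter open_imp_gdelta_in) auto
  qed
  moreover have "closure (\<Inter>\<D>) = UNIV"
    by (rule Baire_dense) (use \<D> in auto)
  ultimately show "residual S"
    unfolding residual_def using \<D>(3) by blast
qed

lemma residual_imp_dense:
  fixes S :: "'a::topological_space set"
  shows "residual S \<Longrightarrow> closure S = UNIV"
  unfolding residual_def using closure_mono by blast

lemma residual_mono:
  "residual S \<Longrightarrow> S \<subseteq> S' \<Longrightarrow> residual S'"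
  unfolding residual_def by blast

lemma residual_INT:
  fixes S :: "'i \<Rightarrow> 'a::complete_space set"
  assumes "countable I" "\<And>i. i \<in> I \<Longrightarrow> residual (S i)"
  shows "residual (\<Inter>i\<in>I. S i)"
proof -
  have "\<forall>i\<in>I. \<exists>\<D>. countable \<D> \<and> (\<forall>D\<in>\<D>. open D \<and> closure D = UNIV) \<and> \<Inter>\<D> \<subseteq> S i"
    using assms(2) residual_iff by blast
  from bchoice[OF this] obtain \<D> where \<D>: "\<forall>i\<in>I. countable (\<D> i) \<and>
      (\<forall>D\<in>\<D> i. open D \<and> closure D = UNIV) \<and> \<Inter>(\<D> i) \<subseteq> S i" ..
  show ?thesis
    unfolding residual_iff
  proof (intro exI[of _ "\<Union>i\<in>I. \<D> i"] conjI)
    show "countable (\<Union>i\<in>I. \<D> i)" using assms(1) \<D> by (intro countable_UN) auto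
    show "\<forall>D\<in>\<Union>i\<in>I. \<D> i. open D \<and> closure D = UNIV" using \<D> by simp
    show "\<Inter>(\<Union>i\<in>I. \<D> i) \<subseteq> (\<Inter>i\<in>I. S i)"
    proof (intro subsetI INT_I)
      fix x i assume "x \<in> \<Inter>(\<Union>i\<in>I. \<D> i)" "i \<in> I"
      then have "x \<in> \<Inter>(\<D> i)" by simp
      then show "x \<in> S i" using \<D> \<open>i \<in> I\<close> by blast
    qed
  qed
qed

text \<open>The map sending \<open>y\<close> to \<open>x - y\<close> is a homeomorphism and its own
  inverse, so preimages of dense open sets are dense and open.\<close>

lemma residual_diff_vimage:
  fixes S :: "'a::banach set"
  assumes "residual S"
  shows "residual {y. x - y \<in> S}"
proof -
  obtain \<D> where \<D>: "countable \<D>" "\<forall>D\<in>\<D>. open D \<and> closure D = UNIV" "\<Inter>\<D> \<subseteq> S"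
    using iffD1[OF residual_iff assms] by (elim exE conjE)
  have op: "open ((\<lambda>y. x - y) -` D)" if "open D" for D :: "'a set"
    by (intro open_vimage that continuous_on_diff continuous_on_const continuous_on_id)
  have dense: "closure ((\<lambda>y. x - y) -` D) = UNIV" if D: "closure D = UNIV" for D :: "'a set"
    unfolding dense_iff
  proof (intro allI impI)
    fix U :: "'a set" assume U: "open U \<and> U \<noteq> {}"
    then obtain u where "u \<in> U" by blast
    then have "x - u \<in> (\<lambda>y. x - y) -` U" by simp
    then have "D \<inter> (\<lambda>y. x - y) -` U \<noteq> {}"
      using iffD1[OF dense_iff D] op[of U] U by blast
    then obtain y where "y \<in> D" "x - y \<in> U" by auto
    then have "x - y \<in> (\<lambda>y. x - y) -` D \<inter> U" by simp
    then show "(\<lambda>y. x - y) -` D \<inter> U \<noteq> {}" by blast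
  qed
  show ?thesis
    unfolding residual_iff
  proof (intro exI[of _ "(\<lambda>D. (\<lambda>y. x - y) -` D) ` \<D>"] conjI)
    show "countable ((\<lambda>D. (\<lambda>y. x - y) -` D) ` \<D>)" using \<D>(1) by (rule countable_image)
    show "\<forall>D\<in>(\<lambda>D. (\<lambda>y. x - y) -` D) ` \<D>. open D \<and> closure D = UNIV"
      using \<D>(2) op dense by simp
    show "\<Inter>((\<lambda>D. (\<lambda>y. x - y) -` D) ` \<D>) \<subseteq> {y. x - y \<in> S}"
      using \<D>(3) by auto
  qed
qed

text \<open>Stated for an abstract relation and later applied to
  \<open>mean_Li_Yorke_pair T\<close>. Since each section of \<open>R\<close> is residual, one new
  point can be related to countably many given points at once and still be placed in any nonempty
  open set.\<close>

lemma dense_uncountable_pairwise: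
  fixes R :: "'a::complete_space \<Rightarrow> 'a \<Rightarrow> bool"
  assumes sep: "separable_space (euclidean :: 'a topology)"
    and sym: "symp R" and irrefl: "\<And>x. \<not> R x x" and res: "\<And>x. residual {y. R x y}"
  shows "\<exists>S. closure S = UNIV \<and> uncountable S \<and> pairwise R S"
proof -
  obtain D :: "'a set" where D: "countable D" "closure D = UNIV"
    using sep unfolding separable_space_def by auto
  then have "D \<noteq> {}" by auto
  \<comment> \<open>Every nonempty open set contains one of these countably many balls
    (\<open>base\<close> below), so a set that meets them all is dense.\<close>
  define \<U> where "\<U> = (\<lambda>(d, n). ball d (1 / real (Suc n))) ` (D \<times> (UNIV :: nat set))"
  have c\<U>: "countable \<U>" "\<U> \<noteq> {}"
    unfolding \<U>_def using D(1) \<open>D \<noteq> {}\<close> by auto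
  define U where "U = from_nat_into \<U>"
  have rU: "range U = \<U>"
    unfolding U_def using range_from_nat_into[OF c\<U>(2,1)] .
  have U: "open (U n) \<and> U n \<noteq> {}" for n
  proof -
    have "U n \<in> \<U>" using rU by blast
    then obtain d k where "U n = ball d (1 / real (Suc k))" unfolding \<U>_def by auto
    then show ?thesis by (simp add: ball_eq_empty del: of_nat_Suc)
  qed
  have base: "\<exists>n. U n \<subseteq> V" if V: "open V" "V \<noteq> {}" for V
  proof -
    obtain d where d: "d \<in> D" "d \<in> V"
      using D(2) V unfolding dense_iff by blast
    then obtain e where e: "e > 0" "ball d e \<subseteq> V"
      using V open_contains_ball by blast
    then obtain n where "1 / real (Suc n) < e"
      using nat_approx_posE by (metis)
    then have "ball d (1 / real (Suc n)) \<subseteq> V" using e by auto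
    moreover have "ball d (1 / real (Suc n)) \<in> range U"
      unfolding rU \<U>_def using d by (intro image_eqI[of _ _ "(d, n)"]) auto
    ultimately show ?thesis by (metis imageE)
  qed
  have extend: "\<exists>y\<in>V. \<forall>x\<in>F. R x y" if "countable F" "open V" "V \<noteq> {}" for F V
  proof -
    have "closure (\<Inter>x\<in>F. {y. R x y}) = UNIV"
      using res that(1) by (intro residual_imp_dense residual_INT)
    then show ?thesis using that unfolding dense_iff by blast
  qed
  \<comment> \<open>\<open>pairwise\<close> asks for both orders of two points; symmetry of
    \<open>R\<close> provides the second.\<close>
  have insert: "pairwise R (insert y F)" if "pairwise R F" "\<forall>x\<in>F. R x y" for y F
    using that sym by (auto simp: pairwise_insert symp_def)
  \<comment> \<open>Stage \<open>n\<close> adds one point of \<open>U n\<close> related to all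
    earlier points, starting from the empty set.\<close>
  have "\<exists>f. \<forall>n. (countable (f n) \<and> pairwise R (f n)) \<and> (f n \<subseteq> f (Suc n) \<and> f (Suc n) \<inter> U n \<noteq> {})"
  proof (rule dependent_nat_choice)
    fix F n assume F: "countable F \<and> pairwise R F"
    then obtain y where "y \<in> U n" "\<forall>x\<in>F. R x y"
      using extend U by metis
    then show "\<exists>F'. (countable F' \<and> pairwise R F') \<and> F \<subseteq> F' \<and> F' \<inter> U n \<noteq> {}"
      using F insert by (intro exI[of _ "insert y F"]) auto
  qed (auto intro: exI[of _ "{}"])
  then obtain f where f: "\<And>n. pairwise R (f n)" "\<And>n. f n \<subseteq> f (Suc n)" "\<And>n. f (Suc n) \<inter> U n \<noteq> {}"
    by blast
  have mono: "f m \<subseteq> f n" if "m \<le> n" for m n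
    using lift_Suc_mono_le[of f] f(2) that by blast
  define S0 where "S0 = (\<Union>n. f n)"
  have "chain\<^sub>\<subseteq> (range f)"
    unfolding chain_subset_def using mono nat_le_linear by blast
  then have S0: "pairwise R S0"
    unfolding S0_def using f(1) by (intro pairwise_chain_Union) auto
  have dense: "closure S0 = UNIV"
    unfolding dense_iff
  proof (intro allI impI)
    fix V :: "'a set" assume "open V \<and> V \<noteq> {}"
    then obtain n where "U n \<subseteq> V" using base by blast
    moreover obtain y where "y \<in> f (Suc n)" "y \<in> U n" using f(3) by blast
    ultimately show "S0 \<inter> V \<noteq> {}" unfolding S0_def by blast
  qed
  \<comment> \<open>Zorn's lemma is applied above \<open>S0\<close>, so that the maximal set
    inherits density.\<close>
  have "\<exists>M\<in>{S. S0 \<subseteq> S \<and> pairwise R S}. \<forall>X\<in>{S. S0 \<subseteq> S \<and> pairwise R S}. M \<subseteq> X \<longrightarrow> X = M"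
  proof (rule subset_Zorn_nonempty)
    fix \<C> assume "\<C> \<noteq> {}" and ch: "subset.chain {S. S0 \<subseteq> S \<and> pairwise R S} \<C>"
    then obtain X where "X \<in> \<C>" "S0 \<subseteq> X" by (auto simp: subset_chain_def)
    then have "S0 \<subseteq> \<Union>\<C>" by blast
    moreover have "pairwise R (\<Union>\<C>)"
      by (rule pairwise_chain_Union) (use ch in \<open>auto simp: subset_chain_def chain_subset_def\<close>)
    ultimately show "\<Union>\<C> \<in> {S. S0 \<subseteq> S \<and> pairwise R S}" by blast
  qed (use S0 in blast)
  then obtain M where "M \<in> {S. S0 \<subseteq> S \<and> pairwise R S}"
    and "\<forall>X\<in>{S. S0 \<subseteq> S \<and> pairwise R S}. M \<subseteq> X \<longrightarrow> X = M" ..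
  then have M: "S0 \<subseteq> M" "pairwise R M"
    and max: "\<And>X. S0 \<subseteq> X \<Longrightarrow> pairwise R X \<Longrightarrow> M \<subseteq> X \<Longrightarrow> X = M"
    by simp_all
  have "uncountable M"
  proof
    assume "countable M"
    then obtain y where y: "\<forall>x\<in>M. R x y" using extend[of M UNIV] by auto
    \<comment> \<open>Maximality forces \<open>y\<close> into \<open>M\<close>, whence
      \<open>R y y\<close>, against irreflexivity.\<close>
    then have "insert y M = M"
      using M insert[OF M(2) y] by (intro max) auto
    then show False using y irrefl by auto
  qed
  moreover have "closure M = UNIV" using dense closure_mono[OF M(1)] by auto
  ultimately show ?thesis using M(2) by blast
qed

section \<open>Upper and lower limits\<close>

text \<open>Nonnegativity excludes a negative lower limit, so only the recurrence of small values
  remains to be expressed. This quantified form matches the open sets used with Baire's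
  theorem.\<close>

lemma liminf_ereal_eq_0_iff:
  fixes f :: "nat \<Rightarrow> real"
  assumes "\<And>n. f n \<ge> 0"
  shows "liminf (\<lambda>n. ereal (f n)) = 0 \<longleftrightarrow> (\<forall>e>0. \<forall>N. \<exists>n\<ge>N. f n < e)"
proof
  assume L: "liminf (\<lambda>n. ereal (f n)) = 0"
  show "\<forall>e>0. \<forall>N. \<exists>n\<ge>N. f n < e"
  proof (rule ccontr)
    assume "\<not> ?thesis"
    then obtain e N where e: "e > 0" "\<And>n. n \<ge> N \<Longrightarrow> f n \<ge> e" by (metis not_less)
    then have "\<forall>\<^sub>F n in sequentially. ereal e \<le> ereal (f n)"
      unfolding eventually_sequentially by auto
    then have "ereal e \<le> liminf (\<lambda>n. ereal (f n))" by (rule Liminf_bounded)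
    with L e show False by simp
  qed
next
  assume R: "\<forall>e>0. \<forall>N. \<exists>n\<ge>N. f n < e"
  have "liminf (\<lambda>n. ereal (f n)) \<le> 0"
  proof (rule ccontr)
    assume "\<not> ?thesis"
    then have "0 < liminf (\<lambda>n. ereal (f n))" by simp
    then obtain e where e: "0 < ereal e" "ereal e < liminf (\<lambda>n. ereal (f n))"
      using ereal_dense2 by blast
    then have "\<forall>\<^sub>F n in sequentially. ereal e < ereal (f n)" by (intro less_LiminfD)
    then show False
      using R e(1) unfolding eventually_sequentially by (force simp: not_less)
  qed
  moreover have "0 \<le> liminf (\<lambda>n. ereal (f n))"
    using assms by (intro Liminf_bounded) auto
  ultimately show "liminf (\<lambda>n. ereal (f n)) = 0" by (rule antisym)
qed

lemma limsup_ereal_eq_PInf_iff: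
  fixes f :: "nat \<Rightarrow> real"
  shows "limsup (\<lambda>n. ereal (f n)) = \<infinity> \<longleftrightarrow> (\<forall>k. \<forall>N. \<exists>n\<ge>N. f n > k)"
proof
  assume L: "limsup (\<lambda>n. ereal (f n)) = \<infinity>"
  show "\<forall>k. \<forall>N. \<exists>n\<ge>N. f n > k"
  proof (rule ccontr)
    assume "\<not> ?thesis"
    then obtain k N where "\<And>n. n \<ge> N \<Longrightarrow> f n \<le> k" by (metis not_less)
    then have "\<forall>\<^sub>F n in sequentially. ereal (f n) \<le> ereal k"
      unfolding eventually_sequentially by auto
    then have "limsup (\<lambda>n. ereal (f n)) \<le> ereal k" by (rule Limsup_bounded)
    with L show False by simp
  qed
next
  assume R: "\<forall>k. \<forall>N. \<exists>n\<ge>N. f n > k"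
  show "limsup (\<lambda>n. ereal (f n)) = \<infinity>"
  proof (rule ccontr)
    assume "\<not> ?thesis"
    then obtain k where "limsup (\<lambda>n. ereal (f n)) < ereal k"
      using less_PInf_Ex_of_nat by (metis ereal_less_PInfty ereal_infty_less(1))
    then have "\<forall>\<^sub>F n in sequentially. ereal (f n) < ereal k" by (rule Limsup_lessD)
    then show False
      using R unfolding eventually_sequentially by (force dest: less_asym)
  qed
qed

section \<open>Averages along a sequence of bounded operators\<close>

locale bounded_operators =
  fixes T :: "nat \<Rightarrow> 'a::real_normed_vector \<Rightarrow> 'a"
  assumes bounded: "\<And>i. i \<ge> 1 \<Longrightarrow> bounded_linear (T i)"
begin

lemma mean_norm_nonneg: "0 \<le> mean_norm T x n"
  unfolding mean_norm_def by (simp add: sum_nonneg)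

text \<open>By linearity every notion about a pair becomes one about the difference of its
  points.\<close>

lemma mean_dist_eq: "mean_dist T x y = mean_norm T (x - y)"
  unfolding mean_dist_def mean_norm_def
  by (intro ext arg_cong2[where f = "(*)"] sum.cong) (auto simp: linear_diff bounded bounded_linear.linear)

lemma mean_norm_scaleR: "mean_norm T (c *\<^sub>R x) n = \<bar>c\<bar> * mean_norm T x n"
proof -
  have "(\<Sum>i=1..n. norm (T i (c *\<^sub>R x))) = (\<Sum>i=1..n. \<bar>c\<bar> * norm (T i x))"
    by (intro sum.cong) (auto simp: linear_scale bounded bounded_linear.linear)
  then show ?thesis unfolding mean_norm_def by (simp add: sum_distrib_left)
qed

lemma mean_norm_minus: "mean_norm T (- x) n = mean_norm T x n"
  using mean_norm_scaleR[of "-1" x n] by simp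

lemma mean_norm_0: "mean_norm T 0 n = 0"
  using mean_norm_scaleR[of 0 0 n] by simp

lemma mean_norm_triangle: "mean_norm T (x + y) n \<le> mean_norm T x n + mean_norm T y n"
proof -
  have "(\<Sum>i=1..n. norm (T i (x + y))) \<le> (\<Sum>i=1..n. norm (T i x) + norm (T i y))"
    by (intro sum_mono) (auto simp: linear_add bounded bounded_linear.linear norm_triangle_ineq)
  then show ?thesis
    unfolding mean_norm_def by (simp add: sum.distrib divide_right_mono flip: add_divide_distrib)
qed

lemma mean_norm_diff_commute: "mean_norm T (x - y) = mean_norm T (y - x)"
  using mean_norm_minus[of "x - y"] by auto

lemma continuous_mean_norm: "continuous_on UNIV (\<lambda>x. mean_norm T x n)"
proof -
  have "continuous_on UNIV (T i)" if "i \<ge> 1" for i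
    using bounded[OF that] linear_continuous_on by blast
  then show ?thesis
    unfolding mean_norm_def by (intro continuous_intros) auto
qed

text \<open>Each single average is continuous, and a union over \<open>n\<close> of open sets is
  open. Sets of this shape are intersected in \<open>residual_irregular\<close>.\<close>

lemma open_mean_norm: "open {x. \<exists>n\<ge>k. mean_norm T x n < c}" "open {x. \<exists>n\<ge>k. mean_norm T x n > c}"
proof -
  have "open {x. mean_norm T x n < c}" "open {x. mean_norm T x n > c}" for n
    using continuous_mean_norm by (auto intro!: open_Collect_less continuous_intros)
  moreover have "{x. \<exists>n\<ge>k. mean_norm T x n < c} = (\<Union>n\<in>{k..}. {x. mean_norm T x n < c})"
    "{x. \<exists>n\<ge>k. mean_norm T x n > c} = (\<Union>n\<in>{k..}. {x. mean_norm T x n > c})" by auto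
  ultimately show "open {x. \<exists>n\<ge>k. mean_norm T x n < c}" "open {x. \<exists>n\<ge>k. mean_norm T x n > c}"
    by auto
qed

section \<open>The notions of the theorem in terms of averages of one vector\<close>

lemma mean_proximal_iff:
  "mean_proximal T x y \<longleftrightarrow> (\<forall>e>0. \<forall>N. \<exists>n\<ge>N. mean_norm T (x - y) n < e)"
  unfolding mean_proximal_def mean_dist_eq by (intro liminf_ereal_eq_0_iff mean_norm_nonneg)

lemma mean_proximal_cell_0: "mean_proximal_cell T 0 = {y. \<forall>e>0. \<forall>N. \<exists>n\<ge>N. mean_norm T y n < e}"
  unfolding mean_proximal_cell_def mean_proximal_iff by (simp add: mean_norm_minus)

lemma absolutely_mean_irregular_iff:
  "absolutely_mean_irregular T x \<longleftrightarrow>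
    (\<forall>e>0. \<forall>N. \<exists>n\<ge>N. mean_norm T x n < e) \<and> (\<forall>k. \<forall>N. \<exists>n\<ge>N. mean_norm T x n > k)"
  unfolding absolutely_mean_irregular_def liminf_ereal_eq_0_iff[of "mean_norm T x", OF mean_norm_nonneg]
    limsup_ereal_eq_PInf_iff ..

lemma mean_Li_Yorke_pair_iff: "mean_Li_Yorke_pair T x y \<longleftrightarrow> absolutely_mean_semi_irregular T (x - y)"
  unfolding mean_Li_Yorke_pair_def mean_proximal_def absolutely_mean_semi_irregular_def mean_dist_eq ..

lemma irregular_imp_semi_irregular:
  "absolutely_mean_irregular T x \<Longrightarrow> absolutely_mean_semi_irregular T x"
  unfolding absolutely_mean_irregular_def absolutely_mean_semi_irregular_def by simp

lemma semi_irregular_imp_cell: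
  "absolutely_mean_semi_irregular T x \<Longrightarrow> x \<in> mean_proximal_cell T 0"
  unfolding absolutely_mean_semi_irregular_def mean_proximal_cell_def mean_proximal_def mean_dist_eq
  by (simp add: mean_norm_minus)

lemma not_semi_irregular_0: "\<not> absolutely_mean_semi_irregular T 0"
  unfolding absolutely_mean_semi_irregular_def by (simp add: mean_norm_0 Limsup_const)

lemma symp_mean_Li_Yorke_pair: "symp (mean_Li_Yorke_pair T)"
  unfolding symp_def mean_Li_Yorke_pair_iff absolutely_mean_semi_irregular_def
  by (simp add: mean_norm_diff_commute)

section \<open>Uniform boundedness, submultiplicativity and decay of averages\<close>

lemma eventually_bounded_if_not_dense:
  assumes "closure {x. \<exists>n\<ge>k. mean_norm T x n > c} \<noteq> UNIV"
  shows "\<exists>K>0. \<forall>x. \<forall>n\<ge>k. mean_norm T x n \<le> K * norm x"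
proof -
  obtain U where U: "open U" "U \<noteq> {}" "{x. \<exists>n\<ge>k. mean_norm T x n > c} \<inter> U = {}"
    using assms unfolding dense_iff by blast
  then obtain a where "a \<in> U" by blast
  with U obtain r where r: "r > 0" "ball a r \<subseteq> U" by (meson open_contains_ball)
  \<comment> \<open>On a ball around \<open>a\<close> all averages from \<open>k\<close> on are at
    most \<open>c\<close>. Writing \<open>x\<close> as \<open>(a + x) - a\<close> moves the bound to
    the origin at the price of a factor 2.\<close>
  have ball: "mean_norm T x n \<le> 2 * c" if "norm x < r" "n \<ge> k" for x n
  proof -
    have "mean_norm T (a + x) n \<le> c" "mean_norm T a n \<le> c"
    proof -
      have "a + x \<in> U" "a \<in> U"
        using r that by (auto simp: dist_norm subset_iff)
      then show "mean_norm T (a + x) n \<le> c" "mean_norm T a n \<le> c"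
        using U(3) that(2) by (auto simp: set_eq_iff not_less)
    qed
    then show ?thesis
      using mean_norm_triangle[of "a + x" "- a" n] by (simp add: mean_norm_minus)
  qed
  \<comment> \<open>Rescaling \<open>x\<close> to norm \<open>r / 2\<close> turns the bound on the
    ball into the factor \<open>4 * \<bar>c\<bar> / r\<close>; the summand 1 makes \<open>K\<close>
    strictly positive.\<close>
  define K where "K = 4 * \<bar>c\<bar> / r + 1"
  have "mean_norm T x n \<le> K * norm x" if "n \<ge> k" for x n
  proof (cases "x = 0")
    case False
    have "mean_norm T ((r / (2 * norm x)) *\<^sub>R x) n \<le> 2 * c"
      using r(1) False that by (intro ball) auto
    then have "r / (2 * norm x) * mean_norm T x n \<le> 2 * \<bar>c\<bar>"
      unfolding mean_norm_scaleR using r(1) by auto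
    then have "mean_norm T x n \<le> 4 * \<bar>c\<bar> / r * norm x"
      using r(1) False by (simp add: field_simps)
    then show ?thesis by (simp add: K_def distrib_right add_increasing2)
  qed (simp add: mean_norm_0)
  moreover have "K > 0" unfolding K_def using r(1) by (simp add: add_nonneg_pos)
  ultimately show ?thesis by blast
qed

text \<open>The least of finitely many numbers does not exceed their average. This extracts a single
  small \<open>T i x\<close> from a small average.\<close>

lemma exists_norm_le_mean_norm:
  assumes "n \<ge> 1"
  shows "\<exists>i\<in>{1..n}. norm (T i x) \<le> mean_norm T x n"
proof (rule ccontr)
  assume "\<not> ?thesis"
  then have "(\<Sum>i=1..n. mean_norm T x n) < (\<Sum>i=1..n. norm (T i x))"
    using assms by (intro sum_strict_mono) (auto simp: not_le)
  then show False using assms by (simp add: mean_norm_def)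
qed

text \<open>The sum is split at \<open>m\<close>. Submultiplicativity compares the tail with the
  averages of \<open>T m y\<close>, which \<open>K\<close> controls; the head is a fixed sum whose
  share vanishes as \<open>n\<close> grows.\<close>

lemma mean_norm_shift:
  assumes C: "C > 0" "\<And>z i m. i \<ge> 1 \<Longrightarrow> m \<ge> 1 \<Longrightarrow> norm (T (i + m) z) \<le> C * norm (T i (T m z))"
    and K: "K > 0" "\<And>x n. n \<ge> k \<Longrightarrow> mean_norm T x n \<le> K * norm x"
    and "m \<ge> 1" "n \<ge> m + k" "n \<ge> 1"
  shows "mean_norm T y n \<le> (\<Sum>i=1..m. norm (T i y)) / n + C * K * norm (T m y)"
proof -
  \<comment> \<open>The tail has \<open>l\<close> terms, and \<open>l \<ge> k\<close> is what makes
    the bound \<open>K\<close> available for it.\<close>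
  obtain l where l: "n = m + l" "l \<ge> k" using assms by (metis le_Suc_ex add.assoc le_add1)
  have "(\<Sum>i=1..n. norm (T i y)) = (\<Sum>i=1..m. norm (T i y)) + (\<Sum>i=1..l. norm (T (i + m) y))"
    unfolding l(1) using sum.ub_add_nat[of 1 m "\<lambda>i. norm (T i y)" l]
      sum.shift_bounds_cl_nat_ivl[of "\<lambda>i. norm (T i y)" 1 m l] by (simp add: add.commute)
  also have "(\<Sum>i=1..l. norm (T (i + m) y)) \<le> (\<Sum>i=1..l. C * norm (T i (T m y)))"
    using C(2) \<open>m \<ge> 1\<close> by (intro sum_mono) auto
  also have "\<dots> = C * (l * mean_norm T (T m y) l)"
    by (simp add: mean_norm_def sum_distrib_left)
  also have "\<dots> \<le> C * (n * (K * norm (T m y)))"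
    using C(1) K l by (intro mult_left_mono mult_mono) (auto simp: mean_norm_nonneg)
  finally have "(\<Sum>i=1..n. norm (T i y)) \<le> (\<Sum>i=1..m. norm (T i y)) + C * (n * (K * norm (T m y)))"
    by simp
  then show ?thesis
    unfolding mean_norm_def using \<open>n \<ge> 1\<close> by (simp add: field_simps)
qed

lemma cell_imp_tendsto_0:
  assumes "submultiplicative T" and K: "K > 0" "\<And>x n. n \<ge> k \<Longrightarrow> mean_norm T x n \<le> K * norm x"
    and y: "y \<in> mean_proximal_cell T 0"
  shows "mean_norm T y \<longlonglongrightarrow> 0"
proof (rule LIMSEQ_I)
  fix e :: real assume "e > 0"
  obtain C where C: "C > 0" "\<And>z i m. i \<ge> 1 \<Longrightarrow> m \<ge> 1 \<Longrightarrow> norm (T (i + m) z) \<le> C * norm (T i (T m z))"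
    using assms(1) unfolding submultiplicative_def by blast
  \<comment> \<open>With this threshold the tail term in \<open>mean_norm_shift\<close> stays below
    \<open>e / 2\<close>.\<close>
  have "e / (2 * (C * K)) > 0" using \<open>e > 0\<close> C K by simp
  \<comment> \<open>At \<open>n = 0\<close> the average is 0 by the convention on division, so a
    positive index is demanded.\<close>
  then obtain n where "n \<ge> 1" "mean_norm T y n < e / (2 * (C * K))"
    using y unfolding mean_proximal_cell_0 by blast
  then obtain m where m: "m \<ge> 1" "norm (T m y) < e / (2 * (C * K))"
    using exists_norm_le_mean_norm[of n y] by force
  then have small: "C * K * norm (T m y) < e / 2"
    using C K by (simp add: field_simps)
  define A where "A = (\<Sum>i=1..m. norm (T i y))"
  \<comment> \<open>The head sum \<open>A\<close> is fixed once \<open>m\<close> is chosen; beyond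
    \<open>N\<close> its share \<open>A / n\<close> is below \<open>e / 2\<close>.\<close>
  obtain N where N: "2 * A / e < real N" using reals_Archimedean2 by blast
  have "norm (mean_norm T y n - 0) < e" if n: "n \<ge> m + k + N" for n
  proof -
    have "2 * A / e < n" using N n by linarith
    then have "A / n < e / 2" using \<open>e > 0\<close> n m by (simp add: field_simps)
    moreover have "mean_norm T y n \<le> A / n + C * K * norm (T m y)"
      unfolding A_def using C K m n by (intro mean_norm_shift[of C K k]) auto
    ultimately have "mean_norm T y n < e" using small by linarith
    then show ?thesis by (simp add: mean_norm_nonneg)
  qed
  then show "\<exists>no. \<forall>n\<ge>no. norm (mean_norm T y n - 0) < e" by blast
qed

text \<open>From \<open>k\<close> on the averages are seminorms with the common Lipschitz constant
  \<open>K\<close>, so convergence to 0 passes from a dense set to its closure.\<close>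

lemma dense_tendsto_0:
  assumes K: "K > 0" "\<And>x n. n \<ge> k \<Longrightarrow> mean_norm T x n \<le> K * norm x"
    and "closure S = UNIV" and S: "\<And>y. y \<in> S \<Longrightarrow> mean_norm T y \<longlonglongrightarrow> 0"
  shows "mean_norm T x \<longlonglongrightarrow> 0"
proof (rule LIMSEQ_I)
  fix e :: real assume "e > 0"
  have "x \<in> closure S" using assms by simp
  moreover have "e / (2 * K) > 0" using \<open>e > 0\<close> K by simp
  ultimately obtain y where y: "y \<in> S" "dist y x < e / (2 * K)"
    unfolding closure_approachable by blast
  then have d: "K * norm (x - y) < e / 2"
    using K(1) by (simp add: dist_norm norm_minus_commute field_simps)
  obtain N where N: "\<And>n. n \<ge> N \<Longrightarrow> norm (mean_norm T y n - 0) < e / 2"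
    using LIMSEQ_D[OF S[OF y(1)], of "e / 2"] \<open>e > 0\<close> by auto
  have "norm (mean_norm T x n - 0) < e" if "n \<ge> max N k" for n
    using mean_norm_triangle[of "x - y" y n] K(2)[of n "x - y"] N[of n] d that mean_norm_nonneg[of x n]
    by simp
  then show "\<exists>no. \<forall>n\<ge>no. norm (mean_norm T x n - 0) < e" by blast
qed

text \<open>Failure for a single choice of \<open>k\<close> and \<open>c\<close> already yields the
  bound \<open>K\<close>, and with it the limit 0 at the given \<open>x\<close>, contrary to its
  positive upper limit.\<close>

lemma dense_mean_norm_gt:
  assumes "submultiplicative T" and "closure (mean_proximal_cell T 0) = UNIV"
    and "limsup (\<lambda>n. ereal (mean_norm T x n)) > 0"
  shows "closure {x. \<exists>n\<ge>k. mean_norm T x n > c} = UNIV"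
proof (rule ccontr)
  assume "\<not> ?thesis"
  then obtain K where K: "K > 0" "\<And>x n. n \<ge> k \<Longrightarrow> mean_norm T x n \<le> K * norm x"
    using eventually_bounded_if_not_dense by blast
  then have "mean_norm T x \<longlonglongrightarrow> 0"
    using dense_tendsto_0[OF K] cell_imp_tendsto_0[OF assms(1) K] assms(2) by blast
  then have "(\<lambda>n. ereal (mean_norm T x n)) \<longlonglongrightarrow> ereal 0" by (rule tendsto_ereal)
  then have "limsup (\<lambda>n. ereal (mean_norm T x n)) = 0"
    using lim_imp_Limsup[OF sequentially_bot] by (metis zero_ereal_def)
  with assms(3) show False by simp
qed

section \<open>Implications between pairs, single vectors and sensitivity\<close>

lemma dense_semi_irregular_of_pairs:
  "closure {(x, y). mean_Li_Yorke_pair T x y} = UNIV \<Longrightarrow>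
    closure {x. absolutely_mean_semi_irregular T x} = UNIV"
  unfolding mean_Li_Yorke_pair_iff by (rule dense_differences)

lemma dense_cell_of_relation:
  "closure (mean_proximal_relation T) = UNIV \<Longrightarrow> closure (mean_proximal_cell T 0) = UNIV"
  unfolding mean_proximal_relation_def mean_proximal_cell_0 mean_proximal_iff by (rule dense_differences)

text \<open>Points of \<open>S\<close> are dense near both coordinates, but \<open>pairwise\<close>
  concerns distinct points only. Near the diagonal a second point must therefore be found, which
  requires that no point be isolated.\<close>

lemma chaotic_imp_dense_pairs:
  assumes "densely_mean_Li_Yorke_chaotic T"
  shows "closure {(x, y). mean_Li_Yorke_pair T x y} = UNIV"
  unfolding dense_iff
proof (intro allI impI)
  obtain S where S: "closure S = UNIV" "uncountable S" "pairwise (mean_Li_Yorke_pair T) S"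
    using assms unfolding densely_mean_Li_Yorke_chaotic_def mean_Li_Yorke_scrambled_def by blast
  \<comment> \<open>An uncountable \<open>S\<close> rules out the zero space, in which the only
    point is isolated.\<close>
  have nontrivial: "\<exists>z::'a. z \<noteq> 0"
    using S(2) by (metis countable_finite finite.emptyI finite_insert rev_finite_subset singletonI subsetI)
  have no_isolated: "V - {x} \<noteq> {}" if V: "open V" "V \<noteq> {}" for V and x :: 'a
  proof
    assume "V - {x} = {}"
    then have "V = {x}" using V by blast
    then obtain e where e: "e > 0" "ball x e \<subseteq> {x}"
      using V open_contains_ball by blast
    obtain z :: 'a where "z \<noteq> 0" using nontrivial by blast
    \<comment> \<open>Moving from \<open>x\<close> by \<open>e / 2\<close> in the direction of
      \<open>z\<close> stays in the ball and leaves \<open>x\<close>.\<close>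
    then have "x + (e / (2 * norm z)) *\<^sub>R z \<in> ball x e" "x + (e / (2 * norm z)) *\<^sub>R z \<noteq> x"
      using e(1) by (auto simp: dist_norm)
    then show False using e(2) by blast
  qed
  fix W :: "('a \<times> 'a) set" assume W: "open W \<and> W \<noteq> {}"
  then obtain a b where "(a, b) \<in> W" by fastforce
  then obtain U V where UV: "open U" "open V" "a \<in> U" "b \<in> V" "U \<times> V \<subseteq> W"
    using W by (metis mem_Sigma_iff open_prod_elim)
  then obtain x where x: "x \<in> S" "x \<in> U"
    using S(1) unfolding dense_iff by blast
  have "open (V - {x})" "V - {x} \<noteq> {}" using UV no_isolated by (auto simp: open_delete)
  then obtain y where "y \<in> S" "y \<in> V" "y \<noteq> x"
    using S(1) unfolding dense_iff by blast
  then have "(x, y) \<in> W" "mean_Li_Yorke_pair T x y"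
    using x UV S(3) by (auto simp: pairwise_def)
  then show "{(x, y). mean_Li_Yorke_pair T x y} \<inter> W \<noteq> {}" by blast
qed

lemma dense_irregular_imp_mean_sensitive:
  assumes "closure {x. absolutely_mean_irregular T x} = UNIV"
  shows "mean_sensitive T"
  unfolding mean_sensitive_def
\<comment> \<open>The constant 1 is arbitrary: a small irregular \<open>z\<close> gives the nearby
  point \<open>x - z\<close>, whose averaged distance from \<open>x\<close> has infinite upper
  limit.\<close>
proof (intro exI[of _ 1] conjI allI impI)
  fix x :: 'a and \<epsilon> :: real assume "\<epsilon> > 0"
  then obtain z where "absolutely_mean_irregular T z" "norm z < \<epsilon>"
    using assms closure_approachable[of 0] by (metis UNIV_I dist_0_norm dist_commute mem_Collect_eq)
  then show "\<exists>y. norm (x - y) < \<epsilon> \<and> limsup (\<lambda>n. ereal (mean_dist T x y n)) > ereal 1"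
    by (intro exI[of _ "x - z"]) (simp add: mean_dist_eq absolutely_mean_irregular_def)
qed simp

end

section \<open>Applications of Baire's theorem in a Banach space\<close>

locale banach_operators = bounded_operators T
  for T :: "nat \<Rightarrow> 'a::banach \<Rightarrow> 'a"
begin

text \<open>Irregularity is a countable intersection of open conditions: those on small averages are
  dense because they contain the cell, those on large averages by
  \<open>dense_mean_norm_gt\<close>.\<close>

lemma residual_irregular:
  assumes "submultiplicative T" and "closure (mean_proximal_cell T 0) = UNIV"
    and "limsup (\<lambda>n. ereal (mean_norm T x n)) > 0"
  shows "residual {x. absolutely_mean_irregular T x}"
proof -
  \<comment> \<open>The same \<open>k\<close> bounds the index from below and sets the threshold, so
    one sequence of sets suffices for each condition; \<open>max k N\<close> later recovers
    independent choices.\<close>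
  define E F where "E = (\<lambda>k. {x. \<exists>n\<ge>k. mean_norm T x n < 1 / Suc k})"
    and "F = (\<lambda>k. {x. \<exists>n\<ge>k. mean_norm T x n > real k})"
  have "open (E k)" "open (F k)" for k
    unfolding E_def F_def by (rule open_mean_norm)+
  moreover have "closure (E k) = UNIV" for k
  proof -
    have "mean_proximal_cell T 0 \<subseteq> E k" unfolding mean_proximal_cell_0 E_def by auto
    then show ?thesis using assms(2) closure_mono by blast
  qed
  moreover have "closure (F k) = UNIV" for k
    unfolding F_def by (rule dense_mean_norm_gt[OF assms])
  moreover have "x \<in> {x. absolutely_mean_irregular T x}" if x: "\<And>k. x \<in> E k" "\<And>k. x \<in> F k" for x
    unfolding mem_Collect_eq absolutely_mean_irregular_iff
  proof (intro conjI allI impI)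
    fix e :: real and N assume "e > 0"
    then obtain k where "1 / Suc k < e" using nat_approx_posE by metis
    moreover have "1 / Suc (max k N) \<le> 1 / Suc k"
      by (intro divide_left_mono) auto
    moreover obtain n where "n \<ge> max k N" "mean_norm T x n < 1 / Suc (max k N)"
      using x(1)[of "max k N"] unfolding E_def by blast
    ultimately show "\<exists>n\<ge>N. mean_norm T x n < e"
      by (intro exI[of _ n]) linarith
  next
    fix c :: real and N
    obtain k where "c < real k" using reals_Archimedean2 by blast
    moreover have "real k \<le> real (max k N)" by simp
    moreover obtain n where "n \<ge> max k N" "mean_norm T x n > real (max k N)"
      using x(2)[of "max k N"] unfolding F_def by blast
    ultimately show "\<exists>n\<ge>N. mean_norm T x n > c"
      by (intro exI[of _ n]) linarith
  qed
  ultimately show ?thesis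
    unfolding residual_iff by (intro exI[of _ "range E \<union> range F"]) auto
qed

text \<open>For fixed \<open>x\<close> the reflection \<open>x - y\<close> keeps residuality, and
  irregular differences give mean Li-Yorke pairs. Irreflexivity holds since 0 is not
  semi-irregular.\<close>

lemma residual_irregular_imp_chaotic:
  assumes "separable_space (euclidean :: 'a topology)"
    and "residual {x. absolutely_mean_irregular T x}"
  shows "densely_mean_Li_Yorke_chaotic T"
  unfolding densely_mean_Li_Yorke_chaotic_def mean_Li_Yorke_scrambled_def
proof (rule dense_uncountable_pairwise)
  show "residual {y. mean_Li_Yorke_pair T x y}" for x
    using residual_diff_vimage[OF assms(2), of x]
    by (rule residual_mono) (auto simp: mean_Li_Yorke_pair_iff irregular_imp_semi_irregular)
qed (use assms(1) symp_mean_Li_Yorke_pair in \<open>auto simp: mean_Li_Yorke_pair_iff not_semi_irregular_0\<close>)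

end

section \<open>Assembling the equivalences\<close>

theorem theorem4p4:
  fixes T :: "nat \<Rightarrow> 'a::banach \<Rightarrow> 'a"
  assumes separable: "separable_space (euclidean :: 'a topology)"
    and bounded: "\<And>i. i \<ge> 1 \<Longrightarrow> bounded_linear (T i)"
    and submult: "submultiplicative T"
  defines "A1 \<equiv> densely_mean_Li_Yorke_chaotic T"
    and "A2 \<equiv> closure {(x, y). mean_Li_Yorke_pair T x y} = UNIV"
    and "A3 \<equiv> closure {x. absolutely_mean_semi_irregular T x} = UNIV"
    and "A4 \<equiv> residual {x. absolutely_mean_irregular T x}"
    and "A5 \<equiv> closure (mean_proximal_relation T) = UNIV \<and> mean_sensitive T"
    and "A6 \<equiv> closure (mean_proximal_cell T 0) = UNIV \<and>
               (\<exists>x. limsup (\<lambda>n. ereal (mean_norm T x n)) > 0)"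
  shows "(A1 \<longleftrightarrow> A2) \<and> (A2 \<longleftrightarrow> A3) \<and> (A3 \<longleftrightarrow> A4) \<and> (A4 \<longleftrightarrow> A5) \<and> (A5 \<longleftrightarrow> A6)"
proof -
  interpret banach_operators T
    by (intro banach_operators.intro bounded_operators.intro bounded)
  \<comment> \<open>The cycle runs through \<open>A1\<close>, \<open>A2\<close>, \<open>A3\<close>,
    \<open>A6\<close>, \<open>A4\<close> and back to \<open>A1\<close>. \<open>A5\<close> is
    attached to it by following from \<open>A2\<close> with \<open>A4\<close> and by implying
    \<open>A6\<close>.\<close>
  have "A1 \<Longrightarrow> A2"
    unfolding A1_def A2_def by (rule chaotic_imp_dense_pairs)
  moreover have "A2 \<Longrightarrow> A3"
    unfolding A2_def A3_def by (rule dense_semi_irregular_of_pairs)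
  moreover have "A3 \<Longrightarrow> A6"
  proof -
    assume A3
    then have d: "closure {x. absolutely_mean_semi_irregular T x} = UNIV" unfolding A3_def .
    then obtain x where "absolutely_mean_semi_irregular T x" by fastforce
    moreover have "closure (mean_proximal_cell T 0) = UNIV"
      using closure_mono[of "{x. absolutely_mean_semi_irregular T x}" "mean_proximal_cell T 0"] d
        semi_irregular_imp_cell by blast
    ultimately show A6 unfolding A6_def absolutely_mean_semi_irregular_def by blast
  qed
  moreover have "A6 \<Longrightarrow> A4"
    unfolding A6_def A4_def using residual_irregular[OF submult] by blast
  moreover have "A4 \<Longrightarrow> A1"
    unfolding A4_def A1_def using residual_irregular_imp_chaotic[OF separable] by blast
  moreover have "A5" if A2 A4
  proof -
    have "{(x, y). mean_Li_Yorke_pair T x y} \<subseteq> mean_proximal_relation T"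
      unfolding mean_Li_Yorke_pair_def mean_proximal_relation_def by blast
    then have "closure (mean_proximal_relation T) = UNIV"
      using that(1) closure_mono unfolding A2_def by blast
    moreover have "mean_sensitive T"
      using that(2) unfolding A4_def by (intro dense_irregular_imp_mean_sensitive residual_imp_dense)
    ultimately show A5 unfolding A5_def by blast
  qed
  moreover have "A6" if A5
  proof -
    \<comment> \<open>Sensitivity is used at the point 0 with radius 1; the resulting
      \<open>0 - y\<close> is the vector required by \<open>A6\<close>.\<close>
    obtain \<delta> y where "\<delta> > 0" "limsup (\<lambda>n. ereal (mean_norm T (0 - y) n)) > ereal \<delta>"
      using \<open>A5\<close> unfolding A5_def mean_sensitive_def mean_dist_eq by (metis zero_less_one)
    then have "limsup (\<lambda>n. ereal (mean_norm T (0 - y) n)) > 0"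
      by (metis ereal_less(2) less_trans)
    then show A6 using \<open>A5\<close> dense_cell_of_relation unfolding A5_def A6_def by blast
  qed
  ultimately show ?thesis by blast
qed

end
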